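(* Let $n\ge1$, $R>0$, and let $\rho_l,\rho_r>0$ and $u_l>u_r$ be real constants. Consider the system $$\partial_t\rho+\partial_r(\rho u)+\tfrac{n-1}{r}\rho u=0,\qquad \partial_t(\rho u)+\partial_r(\rho u^2)+\tfrac{n-1}{r}\rho u^2=0$$ with pseudo-Riemann initial data $$(\rho,u)|_{t=0}=\begin{cases}(\rho_l r^{1-n},u_l), & r<R,\\ (\rho_r r^{1-n},u_r), & r>R.\end{cases}$$ Then any physical and dissipative local shadow wave solution with these initial data, with front $r=R+c(t)$, has constant velocity $\dot c$. This holds true as long as no interaction with another wave takes place, i.e. on every time interval $[0,T)$ throughout which the states immediately to the left and right of the front are $(\rho_l r^{1-n},u_l)$ and $(\rho_r r^{1-n},u_r)$, evaluated at $r=R+c(t)$.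
   Context: Jump notation: $[f]=f_1-f_0$, with $f_0,f_1$ formed from $(\rho_0,u_0)$, $(\rho_1,u_1)$ and evaluated at $(R+c(t),t)$. Set $\kappa_1=\dot c[\rho]-[\rho u]$ and $\kappa_2=\dot c[\rho u]-[\rho u^2]$. A local shadow wave solution on $[0,T)$ with front $r=R+c(t)>0$, $c(0)=0$, is a family, indexed by $\varepsilon>0$, $(\rho^\varepsilon_{sw},u^\varepsilon_{sw})$ equal to $(\rho_0,u_0)$ for $r<R+c(t)-\varepsilon/2$, to $(\sigma(t)/\varepsilon,\,v(t))$ for $|r-R-c(t)|<\varepsilon/2$, and to $(\rho_1,u_1)$ for $r>R+c(t)+\varepsilon/2$, where $\sigma,v\in C^1([0,T))$, $(\rho_0,u_0)$ and $(\rho_1,u_1)$ are $C^1$ (up to the front) and solve the system in $\{0<r<R+c(t)\}$ and $\{r>R+c(t)\}$ respectively, $v\equiv\dot c$, and $$\partial_t\sigma+\tfrac{n-1}{R+c(t)}\sigma v=\kappa_1,\qquad \partial_t(\sigma v)+\tfrac{n-1}{R+c(t)}\sigma v^2=\kappa_2 .$$ Having the given (locally integrable) initial data means that $(\rho_0,u_0)$, $(\rho_1,u_1)$ take those data at $t=0$ and that $\sigma(0)=0$ (no initial concentration of mass). The solution is physical if $\sigma(t)\ge0$ on $[0,T)$. It is dissipative if $$\lim_{\varepsilon\to0}\Big(\partial_t\big(\tfrac12\rho^\varepsilon_{sw}(u^\varepsilon_{sw})^2\big)+\partial_r\big(\tfrac12\rho^\varepsilon_{sw}(u^\varepsilon_{sw})^3\big)+\tfrac{n-1}{2r}\rho^\varepsilon_{sw}(u^\varepsilon_{sw})^3\Big)\le0$$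 when applied to nonnegative test functions $\phi\in C_c^\infty(\,]0,\infty[\times]0,T[\,)$. *)

theory Defs
  imports "HOL-Analysis.Analysis"
begin

text \<open>Functions of space and time have the type \<^typ>\<open>real \<times> real \<Rightarrow> real\<close> with arguments
  \<open>(r, t)\<close>. The end of a time interval is an extended real, so that \<open>[0, \<infinity>)\<close> is included.\<close>

definition time_interval :: "ereal \<Rightarrow> real set" where
  "time_interval T = {t. 0 \<le> t \<and> ereal t < T}"

definition open_time_interval :: "ereal \<Rightarrow> real set" where
  "open_time_interval T = {t. 0 < t \<and> ereal t < T}"

text \<open>The derivative is taken within \<open>S\<close>; at boundary points that belong to \<open>S\<close> this is
  continuous differentiability up to the boundary.\<close>

definition C1_on :: "('a::real_normed_vector \<Rightarrow> 'b::real_normed_vector) \<Rightarrow> 'a set \<Rightarrow> bool" where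
  "C1_on f S \<longleftrightarrow> (\<exists>f' :: 'a \<Rightarrow> 'a \<Rightarrow>\<^sub>L 'b.
     (\<forall>x\<in>S. (f has_derivative blinfun_apply (f' x)) (at x within S)) \<and> continuous_on S f')"

definition d_r :: "(real \<times> real \<Rightarrow> real) \<Rightarrow> real \<times> real \<Rightarrow> real" where
  "d_r f = (\<lambda>(r, t). deriv (\<lambda>x. f (x, t)) r)"

definition d_t :: "(real \<times> real \<Rightarrow> real) \<Rightarrow> real \<times> real \<Rightarrow> real" where
  "d_t f = (\<lambda>(r, t). deriv (\<lambda>s. f (r, s)) t)"

primrec C_k :: "nat \<Rightarrow> (real \<times> real \<Rightarrow> real) \<Rightarrow> bool" where
  "C_k 0 f = continuous_on UNIV f"
| "C_k (Suc k) f = (f differentiable_on UNIV \<and> C_k k (d_r f) \<and> C_k k (d_t f))"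

text \<open>\<open>C\<^sub>c\<^sup>\<infinity>\<close> functions on an open set \<open>\<Omega>\<close>, extended by zero to the plane.\<close>

definition test_function :: "(real \<times> real) set \<Rightarrow> (real \<times> real \<Rightarrow> real) \<Rightarrow> bool" where
  "test_function \<Omega> \<phi> \<longleftrightarrow> (\<forall>k. C_k k \<phi>) \<and>
     compact (closure {p. \<phi> p \<noteq> 0}) \<and> closure {p. \<phi> p \<noteq> 0} \<subseteq> \<Omega>"

definition solves_system ::
  "nat \<Rightarrow> (real \<times> real) set \<Rightarrow> (real \<times> real \<Rightarrow> real) \<Rightarrow> (real \<times> real \<Rightarrow> real) \<Rightarrow> bool" where
  "solves_system n \<Omega> \<rho> u \<longleftrightarrow> (\<forall>(r, t)\<in>\<Omega>.
     d_t \<rho> (r, t) + d_r (\<lambda>p. \<rho> p * u p) (r, t)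
       + (real n - 1) / r * (\<rho> (r, t) * u (r, t)) = 0 \<and>
     d_t (\<lambda>p. \<rho> p * u p) (r, t) + d_r (\<lambda>p. \<rho> p * (u p)\<^sup>2) (r, t)
       + (real n - 1) / r * (\<rho> (r, t) * (u (r, t))\<^sup>2) = 0)"

text \<open>The data \<open>(c, \<sigma>, v, \<rho>\<^sub>0, u\<^sub>0, \<rho>\<^sub>1, u\<^sub>1)\<close> that determine the family
  \<open>(\<rho>\<^sub>s\<^sub>w\<^sup>\<epsilon>, u\<^sub>s\<^sub>w\<^sup>\<epsilon>)\<close>, \<open>\<epsilon> > 0\<close>.\<close>

record shadow_wave =
  shift :: "real \<Rightarrow> real"
  strength :: "real \<Rightarrow> real"
  velocity :: "real \<Rightarrow> real"
  rho0 :: "real \<times> real \<Rightarrow> real"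
  u0 :: "real \<times> real \<Rightarrow> real"
  rho1 :: "real \<times> real \<Rightarrow> real"
  u1 :: "real \<times> real \<Rightarrow> real"

definition front :: "real \<Rightarrow> shadow_wave \<Rightarrow> real \<Rightarrow> real" where
  "front R w t = R + shift w t"

text \<open>The values on the null set \<open>\<bar>r - R - c(t)\<bar> = \<epsilon>/2\<close> are a convention.\<close>

definition rho_sw :: "real \<Rightarrow> shadow_wave \<Rightarrow> real \<Rightarrow> real \<times> real \<Rightarrow> real" where
  "rho_sw R w \<epsilon> = (\<lambda>(r, t).
     if r < front R w t - \<epsilon> / 2 then rho0 w (r, t)
     else if r \<le> front R w t + \<epsilon> / 2 then strength w t / \<epsilon>
     else rho1 w (r, t))"

definition u_sw :: "real \<Rightarrow> shadow_wave \<Rightarrow> real \<Rightarrow> real \<times> real \<Rightarrow> real" where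
  "u_sw R w \<epsilon> = (\<lambda>(r, t).
     if r < front R w t - \<epsilon> / 2 then u0 w (r, t)
     else if r \<le> front R w t + \<epsilon> / 2 then velocity w t
     else u1 w (r, t))"

definition jump :: "real \<Rightarrow> shadow_wave \<Rightarrow> (real \<Rightarrow> real \<Rightarrow> real) \<Rightarrow> real \<Rightarrow> real" where
  "jump R w f t =
     f (rho1 w (front R w t, t)) (u1 w (front R w t, t))
     - f (rho0 w (front R w t, t)) (u0 w (front R w t, t))"

definition kappa1 :: "real \<Rightarrow> shadow_wave \<Rightarrow> real \<Rightarrow> real" where
  "kappa1 R w t = velocity w t * jump R w (\<lambda>\<rho> u. \<rho>) t - jump R w (\<lambda>\<rho> u. \<rho> * u) t"

definition kappa2 :: "real \<Rightarrow> shadow_wave \<Rightarrow> real \<Rightarrow> real" where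
  "kappa2 R w t = velocity w t * jump R w (\<lambda>\<rho> u. \<rho> * u) t - jump R w (\<lambda>\<rho> u. \<rho> * u\<^sup>2) t"

text \<open>The states are \<open>C\<^sup>1\<close> up to the front at positive times; at \<open>t = 0\<close> only continuity is
  required, which gives a meaning to attaining the initial data.\<close>

definition local_shadow_wave_solution :: "nat \<Rightarrow> real \<Rightarrow> ereal \<Rightarrow> shadow_wave \<Rightarrow> bool" where
  "local_shadow_wave_solution n R T w \<longleftrightarrow>
     shift w 0 = 0 \<and>
     (\<forall>t\<in>time_interval T. front R w t > 0) \<and>
     C1_on (strength w) (time_interval T) \<and>
     C1_on (velocity w) (time_interval T) \<and>
     (\<forall>t\<in>time_interval T.
        (shift w has_real_derivative velocity w t) (at t within time_interval T)) \<and>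
     (\<forall>f\<in>{rho0 w, u0 w}.
        continuous_on {(r, t). t \<in> time_interval T \<and> 0 < r \<and> r \<le> front R w t} f \<and>
        C1_on f {(r, t). t \<in> open_time_interval T \<and> 0 < r \<and> r \<le> front R w t}) \<and>
     (\<forall>f\<in>{rho1 w, u1 w}.
        continuous_on {(r, t). t \<in> time_interval T \<and> front R w t \<le> r} f \<and>
        C1_on f {(r, t). t \<in> open_time_interval T \<and> front R w t \<le> r}) \<and>
     solves_system n {(r, t). t \<in> open_time_interval T \<and> 0 < r \<and> r < front R w t}
       (rho0 w) (u0 w) \<and>
     solves_system n {(r, t). t \<in> open_time_interval T \<and> front R w t < r}
       (rho1 w) (u1 w) \<and>
     (\<forall>t\<in>time_interval T.
        (strength w has_real_derivative
           kappa1 R w t - (real n - 1) / front R w t * (strength w t * velocity w t))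
          (at t within time_interval T) \<and>
        ((\<lambda>s. strength w s * velocity w s) has_real_derivative
           kappa2 R w t - (real n - 1) / front R w t * (strength w t * (velocity w t)\<^sup>2))
          (at t within time_interval T))"

definition has_initial_data ::
  "real \<Rightarrow> shadow_wave \<Rightarrow> (real \<Rightarrow> real) \<Rightarrow> (real \<Rightarrow> real) \<Rightarrow> (real \<Rightarrow> real) \<Rightarrow> (real \<Rightarrow> real) \<Rightarrow> bool" where
  "has_initial_data R w \<rho>L uL \<rho>R uR \<longleftrightarrow>
     (\<forall>r. 0 < r \<and> r < R \<longrightarrow> rho0 w (r, 0) = \<rho>L r \<and> u0 w (r, 0) = uL r) \<and>
     (\<forall>r. R < r \<longrightarrow> rho1 w (r, 0) = \<rho>R r \<and> u1 w (r, 0) = uR r) \<and>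
     strength w 0 = 0"

definition physical :: "ereal \<Rightarrow> shadow_wave \<Rightarrow> bool" where
  "physical T w \<longleftrightarrow> (\<forall>t\<in>time_interval T. strength w t \<ge> 0)"

text \<open>The pairing of the distribution
  \<open>\<partial>\<^sub>t(\<rho>u\<^sup>2/2) + \<partial>\<^sub>r(\<rho>u\<^sup>3/2) + (n-1)/(2r) \<rho>u\<^sup>3\<close>, formed from the shadow wave with
  parameter \<open>\<epsilon>\<close>, with the test function \<open>\<phi>\<close>.\<close>

definition energy_pairing ::
  "nat \<Rightarrow> real \<Rightarrow> ereal \<Rightarrow> shadow_wave \<Rightarrow> real \<Rightarrow> (real \<times> real \<Rightarrow> real) \<Rightarrow> real" where
  "energy_pairing n R T w \<epsilon> \<phi> =
     (LINT p : {0<..} \<times> open_time_interval T | lborel.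
        - (1 / 2 * rho_sw R w \<epsilon> p * (u_sw R w \<epsilon> p) ^ 2 * d_t \<phi> p)
        - (1 / 2 * rho_sw R w \<epsilon> p * (u_sw R w \<epsilon> p) ^ 3 * d_r \<phi> p)
        + (real n - 1) / (2 * fst p) * rho_sw R w \<epsilon> p * (u_sw R w \<epsilon> p) ^ 3 * \<phi> p)"

definition dissipative :: "nat \<Rightarrow> real \<Rightarrow> ereal \<Rightarrow> shadow_wave \<Rightarrow> bool" where
  "dissipative n R T w \<longleftrightarrow>
     (\<forall>\<phi>. test_function ({0<..} \<times> open_time_interval T) \<phi> \<and> (\<forall>p. \<phi> p \<ge> 0) \<longrightarrow>
        (\<exists>L\<le>0. ((\<lambda>\<epsilon>. energy_pairing n R T w \<epsilon> \<phi>) \<longlongrightarrow> L) (at_right 0)))"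

definition unperturbed_at_front ::
  "nat \<Rightarrow> real \<Rightarrow> ereal \<Rightarrow> shadow_wave \<Rightarrow> real \<Rightarrow> real \<Rightarrow> real \<Rightarrow> real \<Rightarrow> bool" where
  "unperturbed_at_front n R S w \<rho>l ul \<rho>r ur \<longleftrightarrow> (\<forall>t\<in>time_interval S.
     rho0 w (front R w t, t) = \<rho>l * front R w t powi (1 - int n) \<and>
     u0 w (front R w t, t) = ul \<and>
     rho1 w (front R w t, t) = \<rho>r * front R w t powi (1 - int n) \<and>
     u1 w (front R w t, t) = ur)"

end

theory Submission
  imports Defs
begin

text \<open>Multiplying the two equations for the strength by the (n-1)-st power of the front radius
  \<open>x = R + c\<close> absorbs the geometric source terms, so \<open>m = x ^ (n - 1) * \<sigma>\<close> satisfies the planar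
  equations \<open>m' = A c' - B\<close>, \<open>(m c')' = B c' - D\<close> with the jumps \<open>A\<close>, \<open>B\<close>, \<open>D\<close> of the constant
  states. Since \<open>m(0) = c(0) = 0\<close>, this gives \<open>(A c - B t) c' = B c - D t\<close>, and one more
  integration gives \<open>A c\<^sup>2 - 2 B t c + D t\<^sup>2 = 0\<close>. Hence \<open>c / t\<close> is a continuous function with
  values among the roots of a fixed nonzero quadratic polynomial, i.e. a constant.\<close>

lemma convex_time_interval: "convex (time_interval T)"
  unfolding time_interval_def is_interval_convex_1[symmetric] is_interval_1
  by (auto intro: le_less_trans[OF ereal_less_eq(3)[THEN iffD2]])

lemma convex_open_time_interval: "convex (open_time_interval T)"
  unfolding open_time_interval_def is_interval_convex_1[symmetric] is_interval_1
  by (auto intro: le_less_trans[OF ereal_less_eq(3)[THEN iffD2]])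

lemma time_interval_mono: "S \<le> T \<Longrightarrow> time_interval S \<subseteq> time_interval T"
  by (auto simp: time_interval_def intro: less_le_trans)

text \<open>Differentiating the weight produces \<open>(n - 1) / x\<close> times the weighted
  \<open>f * v\<close>, which cancels the source term, and \<open>x ^ (n - 1)\<close> cancels
  \<open>x powi (1 - int n)\<close>. Since \<open>f\<close> is arbitrary, the lemma serves both
  \<sigma> and \<sigma> v.\<close>

lemma radial_weight_derivative:
  fixes f x :: "real \<Rightarrow> real"
  assumes "n \<ge> 1" "x t > 0"
    and x: "(x has_real_derivative v) (at t within I)"
    and f: "(f has_real_derivative K * x t powi (1 - int n) - (real n - 1) / x t * (f t * v))
      (at t within I)"
  shows "((\<lambda>s. x s ^ (n - 1) * f s) has_real_derivative K) (at t within I)"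
proof -
  obtain k where n: "n = Suc k" using assms(1) by (cases n) auto
  have w: "x t ^ k * x t powi (1 - int n) = 1"
    using assms(2) by (simp add: n power_int_minus)
  \<comment> \<open>Writing \<open>real k / x t * x t ^ k\<close> for k x^(k-1) avoids truncated
    subtraction at \<open>k = 0\<close> and matches the form of the source term.\<close>
  have p: "((\<lambda>s. x s ^ k) has_real_derivative real k / x t * x t ^ k * v) (at t within I)"
    by (rule DERIV_cong[OF DERIV_power[OF x]]) (use assms(2) in \<open>cases k; simp\<close>)
  have "((\<lambda>s. x s ^ k * f s) has_real_derivative
      (real k / x t * x t ^ k * v) * f t
      + (K * x t powi (1 - int n) - (real n - 1) / x t * (f t * v)) * x t ^ k) (at t within I)"
    by (rule DERIV_mult[OF p f])
  also have "(real k / x t * x t ^ k * v) * f t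
      + (K * x t powi (1 - int n) - (real n - 1) / x t * (f t * v)) * x t ^ k
      = K * (x t ^ k * x t powi (1 - int n))"
    by (simp add: n algebra_simps)
  finally show ?thesis unfolding w by (simp add: n)
qed

lemma vanishing_if_zero_derivative:
  fixes f :: "real \<Rightarrow> real"
  assumes "convex I" "a \<in> I" "f a = 0"
    and "\<And>t. t \<in> I \<Longrightarrow> (f has_real_derivative 0) (at t within I)"
    and "t \<in> I"
  shows "f t = 0"
  using has_field_derivative_zero_constant[OF assms(1,4)] assms(2,3,5) by metis

text \<open>The equation m c' = B c - D t degenerates at t = 0, where m vanishes, so a uniqueness
  theorem for initial value problems does not apply directly. Exact integration avoids dividing by
  m.\<close>

lemma mass_momentum_balance_linear:
  fixes c m v :: "real \<Rightarrow> real" and A B D :: real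
  assumes S: "0 < S" and c0: "c 0 = 0" and m0: "m 0 = 0"
    and c: "\<And>t. t \<in> time_interval S \<Longrightarrow>
      (c has_real_derivative v t) (at t within time_interval S)"
    and m: "\<And>t. t \<in> time_interval S \<Longrightarrow>
      (m has_real_derivative A * v t - B) (at t within time_interval S)"
    and mv: "\<And>t. t \<in> time_interval S \<Longrightarrow>
      ((\<lambda>s. m s * v s) has_real_derivative B * v t - D) (at t within time_interval S)"
    and AB: "A \<noteq> 0 \<or> B \<noteq> 0"
  shows "\<exists>y. \<forall>t\<in>time_interval S. c t = y * t"
proof -
  let ?I = "time_interval S" and ?J = "open_time_interval S"
  have I: "convex ?I" by (rule convex_time_interval)
  have zero: "0 \<in> ?I" using S by (simp add: time_interval_def zero_ereal_def)
  have mass: "m t = A * c t - B * t" if "t \<in> ?I" for t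
  proof -
    have "m t - (A * c t - B * t) = 0"
      by (rule vanishing_if_zero_derivative[OF I zero _ _ that])
        (auto simp: c0 m0 intro!: derivative_eq_intros m c)
    then show ?thesis by simp
  qed
  have momentum: "m t * v t = B * c t - D * t" if "t \<in> ?I" for t
  proof -
    have "m t * v t - (B * c t - D * t) = 0"
    proof (rule vanishing_if_zero_derivative[OF I zero _ _ that])
      fix t assume t: "t \<in> ?I"
      have "((\<lambda>t. B * c t - D * t) has_real_derivative B * v t - D) (at t within ?I)"
        by (auto intro!: derivative_eq_intros c t)
      from DERIV_diff[OF mv[OF t] this]
      show "((\<lambda>t. m t * v t - (B * c t - D * t)) has_real_derivative 0) (at t within ?I)"
        by simp
    qed (simp add: c0 m0)
    then show ?thesis by simp
  qed
  have quadratic: "A * (c t)\<^sup>2 - 2 * B * t * c t + D * t\<^sup>2 = 0" if "t \<in> ?I" for t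
  proof (rule vanishing_if_zero_derivative[OF I zero _ _ that])
    fix t assume t: "t \<in> ?I"
    \<comment> \<open>The equation is exact: the terms -B t c' and -B c together form the derivative
      of -B t c.\<close>
    have "((\<lambda>t. A * (c t)\<^sup>2 - 2 * B * t * c t + D * t\<^sup>2) has_real_derivative
        2 * ((A * c t - B * t) * v t - (B * c t - D * t))) (at t within ?I)"
      by (auto intro!: derivative_eq_intros c[OF t] simp: algebra_simps)
    then show "((\<lambda>t. A * (c t)\<^sup>2 - 2 * B * t * c t + D * t\<^sup>2) has_real_derivative 0)
        (at t within ?I)"
      using mass[OF t] momentum[OF t] by simp
  qed (simp add: c0)
  let ?p = "[:D, - 2 * B, A:]"
  \<comment> \<open>Time 0 is left out because there \<open>c t / t\<close> has the default value 0
    instead of the limit c'(0), which could break continuity.\<close>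
  have JI: "?J \<subseteq> ?I" by (auto simp: time_interval_def open_time_interval_def)
  have pos: "t > 0" if "t \<in> ?J" for t using that by (simp add: open_time_interval_def)
  have "poly ?p (c t / t) = 0" if "t \<in> ?J" for t
    using quadratic[of t] that JI pos[OF that]
    by (auto simp: field_simps power2_eq_square)
  then have "(\<lambda>t. c t / t) ` ?J \<subseteq> {y. poly ?p y = 0}" by blast
  moreover have "finite {y. poly ?p y = 0}"
    using AB by (intro poly_roots_finite) auto
  ultimately have "finite ((\<lambda>t. c t / t) ` ?J)" by (rule finite_subset)
  moreover have "continuous_on ?I c" by (rule DERIV_continuous_on[OF c])
  then have "continuous_on ?J (\<lambda>t. c t / t)"
    by (intro continuous_intros continuous_on_subset[OF _ JI]) (auto dest: pos)
  ultimately have "(\<lambda>t. c t / t) constant_on ?J"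
    by (intro continuous_finite_range_constant convex_connected convex_open_time_interval)
  then obtain y where y: "\<And>t. t \<in> ?J \<Longrightarrow> c t / t = y"
    by (auto simp: constant_on_def)
  have "c t = y * t" if "t \<in> ?I" for t
  proof (cases "t = 0")
    case False
    then have "t \<in> ?J" using that by (auto simp: time_interval_def open_time_interval_def)
    from y[OF this] False show ?thesis by (simp add: field_simps)
  qed (simp add: c0)
  then show ?thesis by blast
qed

theorem proposition6p1:
  fixes n :: nat and R \<rho>l \<rho>r ul ur :: real and T S :: ereal and w :: shadow_wave
  assumes "n \<ge> 1" and "R > 0" and "\<rho>l > 0" and "\<rho>r > 0" and "ul > ur"
    and "0 < T"
    and "local_shadow_wave_solution n R T w"
    and "has_initial_data R w
           (\<lambda>r. \<rho>l * r powi (1 - int n)) (\<lambda>r. ul) (\<lambda>r. \<rho>r * r powi (1 - int n)) (\<lambda>r. ur)"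
    and "physical T w"
    and "dissipative n R T w"
    and "0 < S" and "S \<le> T"
    and "unperturbed_at_front n R S w \<rho>l ul \<rho>r ur"
  shows "\<exists>s. \<forall>t\<in>time_interval S. (shift w has_real_derivative s) (at t within time_interval S)"
proof -
  let ?I = "time_interval S"
  define c \<sigma> v x where defs: "c = shift w" "\<sigma> = strength w" "v = velocity w" "x = front R w"
  define A B D where ABD: "A = \<rho>r - \<rho>l" "B = \<rho>r * ur - \<rho>l * ul" "D = \<rho>r * ur\<^sup>2 - \<rho>l * ul\<^sup>2"
  define m where "m = (\<lambda>t. x t ^ (n - 1) * \<sigma> t)"
  note sol = assms(7)[unfolded local_shadow_wave_solution_def, folded defs]
  have IT: "?I \<subseteq> time_interval T" by (rule time_interval_mono) fact
  have c: "(c has_real_derivative v t) (at t within ?I)" if "t \<in> ?I" for t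
    using sol IT that by (blast intro: DERIV_subset)
  have x: "(x has_real_derivative v t) (at t within ?I)" if "t \<in> ?I" for t
    unfolding defs(4) front_def
    by (auto intro!: derivative_eq_intros c[OF that, unfolded defs(1)])
  have xpos: "x t > 0" if "t \<in> ?I" for t
    using sol IT that by blast
  have k1: "kappa1 R w t = (A * v t - B) * x t powi (1 - int n)" if "t \<in> ?I" for t
    using assms(13) that
    by (simp add: unperturbed_at_front_def kappa1_def jump_def ABD defs algebra_simps)
  have k2: "kappa2 R w t = (B * v t - D) * x t powi (1 - int n)" if "t \<in> ?I" for t
    using assms(13) that
    by (simp add: unperturbed_at_front_def kappa2_def jump_def ABD defs algebra_simps)
  have \<sigma>: "(\<sigma> has_real_derivative
      kappa1 R w t - (real n - 1) / x t * (\<sigma> t * v t)) (at t within ?I)" if "t \<in> ?I" for t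
    using sol IT that by (blast intro: DERIV_subset)
  have \<sigma>v: "((\<lambda>s. \<sigma> s * v s) has_real_derivative
      kappa2 R w t - (real n - 1) / x t * (\<sigma> t * (v t)\<^sup>2)) (at t within ?I)" if "t \<in> ?I" for t
    using sol IT that by (blast intro: DERIV_subset)
  have m: "(m has_real_derivative A * v t - B) (at t within ?I)" if "t \<in> ?I" for t
    unfolding m_def using \<sigma>[OF that] k1[OF that]
    by (intro radial_weight_derivative[OF assms(1) xpos x]) (simp_all add: that)
  have "((\<lambda>s. x s ^ (n - 1) * (\<sigma> s * v s)) has_real_derivative B * v t - D) (at t within ?I)"
    if "t \<in> ?I" for t
    using \<sigma>v[OF that] k2[OF that]
    by (intro radial_weight_derivative[OF assms(1) xpos x])
      (simp_all add: that power2_eq_square mult.assoc)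
  then have mv: "((\<lambda>s. m s * v s) has_real_derivative B * v t - D) (at t within ?I)"
    if "t \<in> ?I" for t
    using that by (simp add: m_def mult.assoc)
  have c0: "c 0 = 0" using sol by blast
  have m0: "m 0 = 0" using assms(8) by (simp add: m_def defs has_initial_data_def)
  \<comment> \<open>If A = 0, the two densities agree and B = \<rho>r (ur - ul) is negative.\<close>
  have AB: "A \<noteq> 0 \<or> B \<noteq> 0" using assms(4,5) by (auto simp: ABD)
  obtain y where y: "\<And>t. t \<in> ?I \<Longrightarrow> c t = y * t"
    using mass_momentum_balance_linear[OF assms(11) c0 m0 c m mv AB] by blast
  have "(c has_real_derivative y) (at t within ?I)" if "t \<in> ?I" for t
    \<comment> \<open>Any positive \<open>d\<close> would do, as c equals \<open>y * t\<close> on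
      the whole interval within which the derivative is taken.\<close>
    by (rule has_field_derivative_transform_within[where f = "\<lambda>t. y * t" and d = 1])
      (auto intro!: derivative_eq_intros simp: y that)
  then show ?thesis unfolding defs by blast
qed

end
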